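(* Let $\lambda=(\lambda_1,\dots,\lambda_\ell)$ be a partition. Then $$\sum_{T \in \mathcal{R}(\lambda)} q^{\mathsf{comaj}(T)} = q^{\frac{1}{2}\sum_{i=1}^{\ell} \lambda_i (\lambda_i-1)} \prod_{i=1}^{\ell-1} \begin{bmatrix} \lambda_i + \lambda_{i+2} + \lambda_{i+3} + \cdots + \lambda_\ell \\ \lambda_{i+1} + \lambda_{i+2} + \lambda_{i+3} + \cdots + \lambda_\ell \end{bmatrix}_q,$$ where the factor for $i=\ell-1$ is $\begin{bmatrix}\lambda_{\ell-1}\\ \lambda_\ell\end{bmatrix}_q$.
   Context: A partition $\lambda=(\lambda_1,\dots,\lambda_\ell)$ is a sequence of integers with $\lambda_1\ge\cdots\ge\lambda_\ell>0$; its size is $|\lambda|=\sum_i\lambda_i$. The Young diagram of $\lambda$ has $\lambda_i$ left-justified boxes in row $i$, rows numbered from top to bottom. A standard Young tableau (SYT) of shape $\lambda$ is a filling of the diagram with $1,\dots,|\lambda|$, each used once, strictly increasing along rows and down columns. For an SYT $T$ of size $n$, let $r_j(T)$ be the row number containing the entry $j$, and let $T_{<j}$ be the subtableau of entries $1,\dots,j-1$. $T$ is a Richardson tableau if for each $1\le j\le n$ with $r_j(T)\ge 2$, the largest entry of $T_{<j}$ in row $r_j(T)-1$ is greater than every entry of $T_{<j}$ in rows $i\ge r_j(T)$. $\mathcal{R}(\lambda)$ is the set of Richardson tableaux of shape $\lambda$. For an SYT $T$ of size $n$, $i\in\{1,\dots,n-1\}$ is a descent of $T$ if $i+1$ appears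 in a row strictly below that of $i$; otherwise $i$ is an ascent. $\mathsf{comaj}(T)$ is the sum of all ascents of $T$. $q$-notation: $[n]_q=\frac{1-q^n}{1-q}$, $[n]_q!=[1]_q\cdots[n]_q$, $[0]_q!=1$, and $\begin{bmatrix} n\\k\end{bmatrix}_q=\frac{[n]_q!}{[k]_q![n-k]_q!}$ if $n\ge k\ge 0$, and $0$ otherwise. *)

theory Defs
  imports
    "HOL-Library.FuncSet"
    "HOL-Computational_Algebra.Computational_Algebra"
begin

definition is_partition :: "nat list \<Rightarrow> bool" where
  "is_partition lam \<longleftrightarrow> sorted_wrt (\<ge>) lam \<and> (\<forall>x\<in>set lam. x > 0)"

text \<open>Parts, rows and columns are numbered from 1, as is usual for tableaux;
  \<open>part lam i\<close> is meaningful only for \<open>1 \<le> i \<le> length lam\<close>.\<close>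

definition part :: "nat list \<Rightarrow> nat \<Rightarrow> nat" where
  "part lam i = lam ! (i - 1)"

definition diagram :: "nat list \<Rightarrow> (nat \<times> nat) set" where
  "diagram lam = {(i, c). 1 \<le> i \<and> i \<le> length lam \<and> 1 \<le> c \<and> c \<le> part lam i}"

text \<open>A filling is a function on boxes \<open>(row, column)\<close>. It is required to be \<open>undefined\<close>
  outside the diagram, so that distinct functions are distinct tableaux.\<close>

definition SYT :: "nat list \<Rightarrow> (nat \<times> nat \<Rightarrow> nat) set" where
  "SYT lam = {T \<in> extensional (diagram lam).
     bij_betw T (diagram lam) {1..sum_list lam} \<and>
     (\<forall>i c c'. (i, c) \<in> diagram lam \<longrightarrow> (i, c') \<in> diagram lam \<longrightarrow> c < c' \<longrightarrow> T (i, c) < T (i, c')) \<and>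
     (\<forall>i i' c. (i, c) \<in> diagram lam \<longrightarrow> (i', c) \<in> diagram lam \<longrightarrow> i < i' \<longrightarrow> T (i, c) < T (i', c))}"

definition row_of :: "nat list \<Rightarrow> (nat \<times> nat \<Rightarrow> nat) \<Rightarrow> nat \<Rightarrow> nat" where
  "row_of lam T j = (THE i. \<exists>c. (i, c) \<in> diagram lam \<and> T (i, c) = j)"

text \<open>The entries in row \<open>i\<close> of the subtableau \<open>T_{<j}\<close> consisting of the entries \<open>1, \<dots>, j - 1\<close>.\<close>

definition row_entries_lt :: "nat list \<Rightarrow> (nat \<times> nat \<Rightarrow> nat) \<Rightarrow> nat \<Rightarrow> nat \<Rightarrow> nat set" where
  "row_entries_lt lam T j i = {T (i, c) |c. (i, c) \<in> diagram lam \<and> T (i, c) < j}"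

text \<open>The maximum below is taken over a nonempty set: if \<open>j\<close> lies in row \<open>r \<ge> 2\<close> of a standard
  Young tableau, then the entry in the box directly above it is smaller than \<open>j\<close>.\<close>

definition richardson :: "nat list \<Rightarrow> (nat \<times> nat \<Rightarrow> nat) \<Rightarrow> bool" where
  "richardson lam T \<longleftrightarrow>
     (\<forall>j\<in>{1..sum_list lam}. row_of lam T j \<ge> 2 \<longrightarrow>
        (\<forall>i\<ge>row_of lam T j. \<forall>x\<in>row_entries_lt lam T j i.
           x < Max (row_entries_lt lam T j (row_of lam T j - 1))))"

definition richardson_tableaux :: "nat list \<Rightarrow> (nat \<times> nat \<Rightarrow> nat) set" where
  "richardson_tableaux lam = {T \<in> SYT lam. richardson lam T}"

definition descents :: "nat list \<Rightarrow> (nat \<times> nat \<Rightarrow> nat) \<Rightarrow> nat set" where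
  "descents lam T = {i \<in> {1..<sum_list lam}. row_of lam T i < row_of lam T (i + 1)}"

definition ascents :: "nat list \<Rightarrow> (nat \<times> nat \<Rightarrow> nat) \<Rightarrow> nat set" where
  "ascents lam T = {1..<sum_list lam} - descents lam T"

definition comaj :: "nat list \<Rightarrow> (nat \<times> nat \<Rightarrow> nat) \<Rightarrow> nat" where
  "comaj lam T = \<Sum>(ascents lam T)"

definition q_int :: "'a::field \<Rightarrow> nat \<Rightarrow> 'a" where
  "q_int q n = (1 - q ^ n) / (1 - q)"

definition q_fact :: "'a::field \<Rightarrow> nat \<Rightarrow> 'a" where
  "q_fact q n = (\<Prod>k=1..n. q_int q k)"

definition q_binomial :: "'a::field \<Rightarrow> nat \<Rightarrow> nat \<Rightarrow> 'a" where
  "q_binomial q n k = (if k \<le> n then q_fact q n / (q_fact q k * q_fact q (n - k)) else 0)"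

text \<open>The indeterminate \<open>q\<close>, as an element of the field \<open>\<rat>(q)\<close> of rational functions.
  There \<open>1 - q\<close> and all q-factorials are nonzero, so the divisions above are genuine.\<close>

definition qvar :: "rat poly fract" where
  "qvar = to_fract [:0, 1:]"

lemma finite_diagram: "finite (diagram lam)"
proof (rule finite_subset)
  show "diagram lam \<subseteq> (SIGMA i:{1..length lam}. {1..part lam i})"
    by (auto simp: diagram_def)
qed auto

lemma finite_SYT: "finite (SYT lam)"
proof (rule finite_subset)
  show "SYT lam \<subseteq> diagram lam \<rightarrow>\<^sub>E {1..sum_list lam}"
    unfolding SYT_def PiE_def Pi_def bij_betw_def by blast
qed (auto intro: finite_PiE finite_diagram)

lemma finite_richardson_tableaux: "finite (richardson_tableaux lam)"
  unfolding richardson_tableaux_def using finite_SYT by simp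

end

theory Submission
  imports Defs
begin

text \<open>
  Record a tableau by the word of rows of its entries. The Richardson condition says that, going
  back from a letter \<open>r \<ge> 2\<close>, the first letter \<open>\<ge> r - 1\<close> met is \<open>r - 1\<close> itself. This already
  forces the ballot condition, so Richardson tableaux are exactly the words with this property
  and the right content. It also forces every weak descent of the word to end in the letter 1, so
  comaj is the sum of \<open>p - 1\<close> over the positions \<open>p\<close> of the letter 1.

  Deleting the 1s yields a Richardson word for \<open>(\<lambda>\<^sub>2, \<lambda>\<^sub>3, \<dots>)\<close>; conversely, 1s may be inserted
  freely as long as each 2 is immediately preceded by a 1. For a fixed shorter word, the
  generating function of the insertions is computed with the q-Pascal rule, and it depends on the
  shorter word only through its length, its number of 2s and its own comaj.
\<close>

subsection \<open>q-binomial coefficients\<close>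

lemma q_fact_Suc: "q_fact q (Suc k) = q_fact q k * q_int q (Suc k)"
  by (simp add: q_fact_def)

context
  fixes q :: "'a::field"
  assumes q_power_neq_1: "\<And>k. k > 0 \<Longrightarrow> q ^ k \<noteq> 1"
begin

lemma q_int_nonzero: "k > 0 \<Longrightarrow> q_int q k \<noteq> 0"
  using q_power_neq_1[of k] q_power_neq_1[of 1] by (simp add: q_int_def)

lemma q_fact_nonzero: "q_fact q k \<noteq> 0"
  by (simp add: q_fact_def q_int_nonzero)

lemma q_binomial_0: "q_binomial q n 0 = 1"
  using q_fact_nonzero[of n] by (simp add: q_binomial_def) (simp add: q_fact_def)

lemma q_binomial_self: "q_binomial q n n = 1"
  using q_fact_nonzero[of n] by (simp add: q_binomial_def) (simp add: q_fact_def)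

text \<open>After cancelling common factorials, the case \<open>m < n\<close> is the identity
  \<open>[n+1] = [m+1] + q^(m+1) [n-m]\<close> of q-integers. For \<open>n \<le> m\<close> the
  default value 0 of \<open>q_binomial\<close> enters.\<close>

lemma q_binomial_pascal:
  "q_binomial q (Suc n) (Suc m) = q_binomial q n m + q ^ Suc m * q_binomial q n (Suc m)"
proof -
  consider "n < m" | "n = m" | d where "n = Suc (m + d)"
    by (metis less_imp_Suc_add linorder_neqE_nat)
  then show ?thesis
  proof cases
    case 1
    then show ?thesis by (simp add: q_binomial_def)
  next
    case 2
    then show ?thesis by (simp add: q_binomial_self) (simp add: q_binomial_def)
  next
    case (3 d)
    have "1 - q \<noteq> 0" using q_power_neq_1[of 1] by simp
    then have "q_int q (Suc n) = q_int q (Suc m) + q ^ Suc m * q_int q (Suc d)"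
      by (simp add: q_int_def 3 field_simps power_add)
    then show ?thesis
      using q_fact_nonzero q_int_nonzero[of "Suc m"] q_int_nonzero[of "Suc d"]
      by (simp add: q_binomial_def 3 q_fact_Suc[of q "Suc (d + m)"] q_fact_Suc[of q m]
          q_fact_Suc[of q d] Suc_diff_le field_simps)
  qed
qed

end

section \<open>The indeterminate is not a root of unity\<close>

lemma to_fract_power: "to_fract (p ^ k) = to_fract p ^ k"
  by (induction k) (simp_all add: to_fract_mult)

lemma qvar_power_neq_1: "k > 0 \<Longrightarrow> qvar ^ k \<noteq> 1"
proof
  assume k: "k > 0" and "qvar ^ k = 1"
  then have "to_fract ([:0, 1:] ^ k) = (to_fract 1 :: rat poly fract)"
    by (simp only: to_fract_power) (simp add: qvar_def)
  then have "[:0, 1:] ^ k = (1 :: rat poly)"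
    by (simp only: to_fract_eq_iff)
  then have "degree ([:0, 1:] ^ k :: rat poly) = 0"
    by simp
  with k show False by (simp add: degree_power_eq)
qed

subsection \<open>Richardson words\<close>

text \<open>Words are reversed and their letters shifted: the head of the list is the last letter, and the
  letter \<open>i\<close> stands for row \<open>i + 1\<close>.\<close>

fun rich :: "nat list \<Rightarrow> bool" where
  "rich [] \<longleftrightarrow> True"
| "rich (y # v) \<longleftrightarrow> rich v \<and> (\<forall>z. y = Suc z \<longrightarrow> find ((\<le>) z) v = Some z)"

text \<open>The tail \<open>v\<close> holds the letters preceding \<open>y\<close> in reading order,
  so a 0 in position \<open>p\<close> contributes \<open>p - 1\<close>. On Richardson words this
  becomes comaj, see \<open>comaj_eq_zero_stat\<close>.\<close>

fun zero_stat :: "nat list \<Rightarrow> nat" where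
  "zero_stat [] = 0"
| "zero_stat (y # v) = (if y = 0 then length v else 0) + zero_stat v"

text \<open>On tableaux this removes the first row and renumbers the remaining rows.\<close>

fun peel :: "nat list \<Rightarrow> nat list" where
  "peel [] = []"
| "peel (0 # w) = peel w"
| "peel (Suc y # w) = y # peel w"

text \<open>The instance \<open>z = 0\<close> of the condition in \<open>rich\<close>, which is the
  part that \<open>peel\<close> loses. Lists being reversed, the head of \<open>v\<close> is the
  letter just before \<open>y\<close>.\<close>

fun ones_after_zeros :: "nat list \<Rightarrow> bool" where
  "ones_after_zeros [] \<longleftrightarrow> True"
| "ones_after_zeros (y # v) \<longleftrightarrow> ones_after_zeros v \<and> (y = 1 \<longrightarrow> (\<exists>v'. v = 0 # v'))"

lemma find_peel: "find ((\<le>) (Suc z)) w = map_option Suc (find ((\<le>) z) (peel w))"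
  by (induction w rule: peel.induct) auto

lemma find_le_0_iff: "find ((\<le>) (0::nat)) v = Some 0 \<longleftrightarrow> (\<exists>v'. v = 0 # v')"
  by (cases v) auto

text \<open>For a letter at least 2 the backward search looks for positive letters only, so it
  passes over the 0s and commutes with \<open>peel\<close>. For a letter 1 any letter stops the
  search, so the 0 must be adjacent. A letter 0 carries no condition.\<close>

lemma rich_iff_peel: "rich w \<longleftrightarrow> rich (peel w) \<and> ones_after_zeros w"
proof (induction w rule: peel.induct)
  case (3 y w)
  then show ?case
    by (cases y) (auto simp: find_le_0_iff find_peel)
qed auto

lemma count_list_peel: "count_list (peel w) i = count_list w (Suc i)"
  by (induction w rule: peel.induct) auto

lemma length_peel: "length w = count_list w 0 + length (peel w)"
  by (induction w rule: peel.induct) auto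

section \<open>Fibres of \<open>peel\<close>: inserting zeros into a fixed word\<close>

definition insertions :: "nat list \<Rightarrow> nat \<Rightarrow> nat list set" where
  "insertions u a = {w. peel w = u \<and> count_list w 0 = a \<and> ones_after_zeros w}"

lemma length_insertions: "w \<in> insertions u a \<Longrightarrow> length w = length u + a"
  by (auto simp: insertions_def length_peel[of w])

lemma insertions_Nil_0: "insertions [] 0 = {[]}"
proof -
  have "w = []" if "peel w = []" "count_list w 0 = 0" for w
    using length_peel[of w] that by simp
  then show ?thesis by (auto simp: insertions_def)
qed

lemma insertions_Nil_Suc: "insertions [] (Suc a) = (#) 0 ` insertions [] a"
proof -
  have "w \<in> (#) 0 ` insertions [] a" if "w \<in> insertions [] (Suc a)" for w
    using that by (cases w rule: peel.cases) (auto simp: insertions_def)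
  then show ?thesis by (auto simp: insertions_def)
qed

lemma insertions_0_0: "insertions (0 # u) 0 = {}"
proof -
  have "w \<notin> insertions (0 # u) 0" for w
    by (cases w rule: peel.cases) (auto simp: insertions_def)
  then show ?thesis by auto
qed

lemma insertions_Suc_0: "insertions (Suc y # u) 0 = (#) (Suc (Suc y)) ` insertions u 0"
proof -
  have "w \<in> (#) (Suc (Suc y)) ` insertions u 0" if "w \<in> insertions (Suc y # u) 0" for w
    using that by (cases w rule: peel.cases) (auto simp: insertions_def)
  then show ?thesis by (auto simp: insertions_def)
qed

text \<open>Split by the last letter of the longer word: it is an inserted 0, or it is the 1 coming
  from the last letter of \<open>0 # u\<close>, and then a 0 is forced right before it.\<close>

lemma insertions_0_Suc:
  "insertions (0 # u) (Suc a) =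
     (#) 0 ` insertions (0 # u) a \<union> (\<lambda>v. 1 # 0 # v) ` insertions u a"
proof -
  have "w \<in> (#) 0 ` insertions (0 # u) a \<union> (\<lambda>v. 1 # 0 # v) ` insertions u a"
    if "w \<in> insertions (0 # u) (Suc a)" for w
    using that by (cases w rule: peel.cases) (auto simp: insertions_def)
  then show ?thesis by (auto simp: insertions_def)
qed

lemma insertions_Suc_Suc:
  "insertions (Suc y # u) (Suc a) =
     (#) 0 ` insertions (Suc y # u) a \<union> (#) (Suc (Suc y)) ` insertions u (Suc a)"
proof -
  have "w \<in> (#) 0 ` insertions (Suc y # u) a \<union> (#) (Suc (Suc y)) ` insertions u (Suc a)"
    if "w \<in> insertions (Suc y # u) (Suc a)" for w
    using that by (cases w rule: peel.cases) (auto simp: insertions_def)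
  then show ?thesis by (auto simp: insertions_def)
qed

lemmas insertions_rec = insertions_Nil_0 insertions_Nil_Suc insertions_0_0 insertions_Suc_0
  insertions_0_Suc insertions_Suc_Suc

lemma finite_insertions: "finite (insertions u a)"
proof (induction u arbitrary: a)
  case Nil
  show ?case by (induction a) (auto simp: insertions_rec)
next
  case (Cons y u)
  show ?case by (induction a; cases y) (auto simp: insertions_rec Cons)
qed

text \<open>A final 0 adds the length of the rest of the word, which is the same for all of
  \<open>insertions u a\<close>.\<close>

lemma sum_zero_stat_Cons_0:
  "(\<Sum>w\<in>(#) 0 ` insertions u a. q ^ zero_stat w) =
     q ^ (length u + a) * (\<Sum>w\<in>insertions u a. q ^ zero_stat w)" for q :: "'a::comm_ring_1"
  by (subst sum.reindex) (auto simp: sum_distrib_left power_add length_insertions intro!: sum.cong)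

lemma sum_zero_stat_Cons_Suc:
  "(\<Sum>w\<in>(#) (Suc y) ` A. q ^ zero_stat w) = (\<Sum>w\<in>A. q ^ zero_stat w)"
    for q :: "'a::comm_ring_1"
  by (subst sum.reindex) auto

text \<open>Pairs of 0s contribute \<open>a choose 2\<close>; the 0s forced before the 1s contribute
  \<open>zero_stat u\<close> through the letters of \<open>u\<close> before them; each of the other
  \<open>a - count_list u 0\<close> zeros freely contributes between 0 and \<open>length u\<close>,
  whence the q-binomial. The proof splits by the last letter, which turns the claim into the
  q-Pascal rule.\<close>

lemma sum_insertions:
  fixes q :: "'a::field"
  assumes q: "\<And>k. k > 0 \<Longrightarrow> q ^ k \<noteq> 1"
  shows "(\<Sum>w\<in>insertions u a. q ^ zero_stat w) =
    (if count_list u 0 \<le> a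
     then q ^ (zero_stat u + (a choose 2)) * q_binomial q (a - count_list u 0 + length u) (length u)
     else 0)"
proof (induction u arbitrary: a)
  case Nil
  show ?case
  proof (induction a)
    case 0
    then show ?case by (simp add: insertions_rec q_binomial_0[OF q] numeral_2_eq_2)
  next
    case (Suc a)
    then show ?case
      by (simp add: insertions_Nil_Suc sum_zero_stat_Cons_0 q_binomial_0[OF q] numeral_2_eq_2 power_add)
  qed
next
  case (Cons y u)
  define t where "t = count_list u 0"
  define m where "m = length u"
  note IH = Cons.IH[folded t_def m_def]
  show ?case
  proof (cases y)
    case 0
    show ?thesis
    proof (induction a)
      case 0
      then show ?case by (simp add: \<open>y = 0\<close> insertions_rec)
    next
      case (Suc a)
      \<comment> \<open>Appending a 0 and then a 1 is done in two stages, so that the two summation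
        lemmas apply.\<close>
      have "(\<lambda>v. 1 # 0 # v) ` insertions u a = (#) (Suc 0) ` (#) 0 ` insertions u a"
        by (auto simp: image_image)
      then have "(\<Sum>w\<in>insertions (0 # u) (Suc a). q ^ zero_stat w) =
          (\<Sum>w\<in>(#) 0 ` insertions (0 # u) a. q ^ zero_stat w) +
          (\<Sum>w\<in>(#) (Suc 0) ` (#) 0 ` insertions u a. q ^ zero_stat w)"
        unfolding insertions_0_Suc
        by (subst sum.union_disjoint) (auto simp: finite_insertions)
      also have "\<dots> = q ^ (Suc m + a) * (\<Sum>w\<in>insertions (0 # u) a. q ^ zero_stat w) +
          q ^ (m + a) * (\<Sum>w\<in>insertions u a. q ^ zero_stat w)"
        by (simp add: sum_zero_stat_Cons_0 sum_zero_stat_Cons_Suc m_def)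
      also have "\<dots> = (if Suc t \<le> Suc a
        then q ^ (m + zero_stat u + (Suc a choose 2)) * q_binomial q (a - t + Suc m) (Suc m) else 0)"
      proof (cases "t \<le> a")
        case True
        \<comment> \<open>If \<open>t = a\<close>, the first sum vanishes because
          \<open>0 # u\<close> has \<open>a + 1\<close> zeros. Otherwise both sums share a power of
          \<open>q\<close>, and q-Pascal adds the two q-binomials.\<close>
        show ?thesis
        proof (cases "t = a")
          case True
          then show ?thesis
            using Suc.IH \<open>y = 0\<close>
            by (simp add: IH q_binomial_self[OF q] t_def[symmetric] m_def[symmetric]
                numeral_2_eq_2 power_add mult_ac)
        next
          case False
          with True obtain d where d: "a = Suc (t + d)"
            by (metis less_imp_Suc_add nat_less_le)
          have "q_binomial q (Suc (Suc (d + m))) (Suc m) =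
            q_binomial q (Suc (d + m)) m + q ^ Suc m * q_binomial q (Suc (d + m)) (Suc m)"
            by (rule q_binomial_pascal[OF q])
          then show ?thesis
            using Suc.IH \<open>y = 0\<close>
            by (simp add: IH t_def[symmetric] m_def[symmetric] d numeral_2_eq_2 power_add Suc_diff_le)
              (simp add: algebra_simps)
        qed
      next
        case False
        then show ?thesis
          using Suc.IH \<open>y = 0\<close> by (simp add: IH t_def[symmetric])
      qed
      finally show ?case by (simp add: \<open>y = 0\<close> t_def m_def)
    qed
  next
    case y: (Suc z)
    show ?thesis
    proof (induction a)
      case 0
      show ?case
        by (simp add: y insertions_rec sum_zero_stat_Cons_Suc IH q_binomial_self[OF q]
            t_def[symmetric] m_def[symmetric] )
    next
      case (Suc a)
      have "(\<Sum>w\<in>insertions (Suc z # u) (Suc a). q ^ zero_stat w) =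
          (\<Sum>w\<in>(#) 0 ` insertions (Suc z # u) a. q ^ zero_stat w) +
          (\<Sum>w\<in>(#) (Suc (Suc z)) ` insertions u (Suc a). q ^ zero_stat w)"
        unfolding insertions_Suc_Suc
        by (subst sum.union_disjoint) (auto simp: finite_insertions)
      also have "\<dots> = q ^ (Suc m + a) * (\<Sum>w\<in>insertions (Suc z # u) a. q ^ zero_stat w) +
          (\<Sum>w\<in>insertions u (Suc a). q ^ zero_stat w)"
        by (simp add: sum_zero_stat_Cons_0 sum_zero_stat_Cons_Suc m_def)
      also have "\<dots> = (if t \<le> Suc a
        then q ^ (zero_stat u + (Suc a choose 2)) * q_binomial q (Suc a - t + Suc m) (Suc m) else 0)"
      proof -
        \<comment> \<open>The middle case is the boundary where only the second sum survives; the
          last one is again q-Pascal.\<close>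
        consider "t > Suc a" | "t = Suc a" | d where "a = t + d"
          by (metis le_Suc_eq le_iff_add linorder_le_less_linear)
        then show ?thesis
        proof cases
          case 1
          then show ?thesis using Suc.IH y by (simp add: IH t_def[symmetric])
        next
          case 2
          then show ?thesis
            using Suc.IH y by (simp add: IH q_binomial_self[OF q] t_def[symmetric])
        next
          case (3 d)
          have "q_binomial q (Suc (Suc (d + m))) (Suc m) =
            q_binomial q (Suc (d + m)) m + q ^ Suc m * q_binomial q (Suc (d + m)) (Suc m)"
            by (rule q_binomial_pascal[OF q])
          then show ?thesis
            using Suc.IH y
            by (simp add: IH t_def[symmetric] m_def[symmetric] 3 numeral_2_eq_2 power_add Suc_diff_le)
              (simp add: algebra_simps)
        qed
      qed
      finally show ?case by (simp add: y t_def m_def)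
    qed
  qed
qed

section \<open>The generating function of Richardson words of given content\<close>

definition rich_words :: "nat list \<Rightarrow> nat list set" where
  "rich_words lam =
     {w. rich w \<and> (\<forall>i. count_list w i = (if i < length lam then lam ! i else 0))}"

lemma rich_words_Nil: "rich_words [] = {[]}"
proof -
  have "w = []" if "\<forall>i. count_list w i = 0" for w :: "nat list"
    using that by (cases w) (auto dest: spec[of _ "hd w"])
  then show ?thesis by (auto simp: rich_words_def)
qed

lemma rich_words_Cons: "rich_words (a # lam) = (\<Union>u\<in>rich_words lam. insertions u a)"
proof -
  have all: "(\<forall>i. P i) \<longleftrightarrow> P 0 \<and> (\<forall>i. P (Suc i))" for P :: "nat \<Rightarrow> bool"
    by (metis not0_implies_Suc)
  have "w \<in> rich_words (a # lam) \<longleftrightarrow> peel w \<in> rich_words lam \<and> w \<in> insertions (peel w) a" for w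
    unfolding rich_words_def insertions_def mem_Collect_eq
    by (subst all, subst rich_iff_peel) (auto simp: count_list_peel)
  moreover have "peel w = u" if "w \<in> insertions u a" for w u
    using that by (simp add: insertions_def)
  ultimately show ?thesis by blast
qed

lemma finite_rich_words: "finite (rich_words lam)"
  by (induction lam) (auto simp: rich_words_Nil rich_words_Cons finite_insertions)

lemma length_rich_words: "w \<in> rich_words lam \<Longrightarrow> length w = sum_list lam"
  by (induction lam arbitrary: w) (auto simp: rich_words_Nil rich_words_Cons length_insertions)

text \<open>Summing over the fibres of \<open>peel\<close>, each fibre sum is
  \<open>q ^ zero_stat u\<close> times a factor independent of \<open>u\<close>: all words for the
  shorter partition have the same length and equally many 0s. Every part thus splits off one
  factor.\<close>

lemma sum_rich_words:
  fixes q :: "'a::field"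
  assumes q: "\<And>k. k > 0 \<Longrightarrow> q ^ k \<noteq> 1" and "sorted_wrt (\<ge>) lam"
  shows "(\<Sum>w\<in>rich_words lam. q ^ zero_stat w) =
    q ^ (\<Sum>x\<leftarrow>lam. x choose 2) *
    (\<Prod>i<length lam - 1.
       q_binomial q (lam ! i + sum_list (drop (i + 2) lam))
         (lam ! Suc i + sum_list (drop (i + 2) lam)))"
  using assms(2)
proof (induction lam)
  case Nil
  show ?case by (simp add: rich_words_Nil)
next
  case (Cons a lam)
  \<comment> \<open>The number of 0s in every shorter word, which is the second part of the
    partition, or 0 if there is none. Sortedness gives \<open>t \<le> a\<close>, hence the nonzero
    branch of \<open>sum_insertions\<close>.\<close>
  define t where "t = (if lam = [] then 0 else hd lam)"
  have t: "t \<le> a"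
    using Cons.prems by (auto simp: t_def)
  have cnt: "count_list u 0 = t" if "u \<in> rich_words lam" for u
    using that by (simp add: rich_words_def t_def hd_conv_nth)
  have "(\<Sum>w\<in>rich_words (a # lam). q ^ zero_stat w) =
      (\<Sum>u\<in>rich_words lam. \<Sum>w\<in>insertions u a. q ^ zero_stat w)"
    unfolding rich_words_Cons
    by (rule sum.UNION_disjoint) (use finite_rich_words finite_insertions in \<open>auto simp: insertions_def\<close>)
  also have "\<dots> = (\<Sum>u\<in>rich_words lam. q ^ zero_stat u *
      (q ^ (a choose 2) * q_binomial q (a - t + sum_list lam) (sum_list lam)))"
    by (rule sum.cong) (simp_all add: sum_insertions[OF q] cnt t length_rich_words power_add)
  also have "\<dots> = (q ^ (a choose 2) * q_binomial q (a - t + sum_list lam) (sum_list lam)) *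
      (\<Sum>u\<in>rich_words lam. q ^ zero_stat u)"
    by (simp add: sum_distrib_right mult.commute)
  finally have *: "(\<Sum>w\<in>rich_words (a # lam). q ^ zero_stat w) = \<dots>" .
  show ?case
  proof (cases lam)
    case Nil
    then show ?thesis using * by (simp add: rich_words_Nil q_binomial_0[OF q])
  next
    case (Cons b mu)
    \<comment> \<open>Here \<open>t = b\<close> cancels against the first summand of
      \<open>sum_list lam\<close>, so the second part drops out of the upper entry.\<close>
    have "a - t + sum_list lam = a + sum_list mu"
      using t by (simp add: t_def Cons)
    note * = *[unfolded this]
    show ?thesis
      using * Cons.IH Cons.prems Cons
      by (simp add: prod.lessThan_Suc_shift power_add del: prod.lessThan_Suc)
  qed
qed

subsection \<open>Richardson tableaux as words\<close>

text \<open>The strict inequality makes the induction work: appending \<open>z\<close> creates the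
  surplus, and \<open>Suc z\<close> may be appended only while \<open>z\<close> is the latest letter
  at least \<open>z\<close>, that is, while the surplus is there.\<close>

lemma rich_ballot:
  assumes "rich v"
  shows "count_list v (Suc z) \<le> count_list v z \<and>
    (find ((\<le>) z) v = Some z \<longrightarrow> count_list v (Suc z) < count_list v z)"
  using assms by (induction v) auto

lemma count_list_rev_map_upt:
  "count_list (rev (map f [1..<Suc n])) z = card {j\<in>{1..n}. f j = z}"
proof (induction n)
  case (Suc n)
  have "{j\<in>{1..Suc n}. f j = z} = (if f (Suc n) = z then {Suc n} else {}) \<union> {j\<in>{1..n}. f j = z}"
    by (auto simp: le_Suc_eq)
  then show ?case using Suc by simp
qed simp

lemma find_rev_map_upt:
  "find P (rev (map f [1..<Suc n])) = Some z \<longleftrightarrow>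
     (\<exists>k\<in>{1..n}. f k = z \<and> P z \<and> (\<forall>k'\<in>{k<..n}. \<not> P (f k')))"
proof (induction n)
  case (Suc n)
  have "{1..Suc n} = insert (Suc n) {1..n}" "\<And>k. k \<le> n \<Longrightarrow> {k<..Suc n} = insert (Suc n) {k<..n}"
    by auto
  then show ?case using Suc by auto
qed auto

lemma rich_rev_map_upt:
  "rich (rev (map f [1..<Suc n])) \<longleftrightarrow>
     (\<forall>j\<in>{1..n}. \<forall>z. f j = Suc z \<longrightarrow>
        (\<exists>k\<in>{1..<j}. f k = z \<and> (\<forall>k'\<in>{k<..<j}. f k' < z)))"
proof (induction n)
  case (Suc n)
  have "{1..Suc n} = insert (Suc n) {1..n}" by auto
  moreover have "find ((\<le>) z) (rev (map f [1..<Suc n])) = Some z \<longleftrightarrow>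
      (\<exists>k\<in>{1..<Suc n}. f k = z \<and> (\<forall>k'\<in>{k<..<Suc n}. f k' < z))" for z
    unfolding find_rev_map_upt
    by (auto simp: atLeastLessThanSuc_atLeastAtMost not_le greaterThanLessThan_def
        lessThan_Suc_atMost greaterThanAtMost_def)
  ultimately show ?case using Suc by auto
qed auto

text \<open>A weak descent of the word ends exactly in a letter 0, and a 0 in position
  \<open>Suc n\<close> adds \<open>n\<close> to both sides.\<close>

lemma zero_stat_rev_map_upt:
  assumes "rich (rev (map f [1..<Suc n]))"
  shows "zero_stat (rev (map f [1..<Suc n])) = \<Sum>{i\<in>{1..<n}. f (Suc i) \<le> f i}"
  using assms
proof (induction n)
  case (Suc n)
  show ?case
  proof (cases "n = 0")
    case False
    have "f (Suc n) \<le> f n \<longleftrightarrow> f (Suc n) = 0"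
    proof (cases "f (Suc n)")
      case (Suc z)
      then have "find ((\<le>) z) (rev (map f [1..<Suc n])) = Some z"
        using Suc.prems by simp
      \<comment> \<open>The search back from \<open>Suc z\<close> either stops at
        \<open>f n\<close>, and then \<open>f n = z\<close>, or skips it, and then
        \<open>f n < z\<close>.\<close>
      then have "\<not> Suc z \<le> f n"
        using False by (auto split: if_splits)
      with Suc show ?thesis by simp
    qed simp
    moreover have "{i\<in>{1..<Suc n}. f (Suc i) \<le> f i} =
        {i\<in>{1..<n}. f (Suc i) \<le> f i} \<union> (if f (Suc n) \<le> f n then {n} else {})"
      using False by (auto simp: less_Suc_eq)
    ultimately show ?thesis
      using Suc by auto
  qed simp
qed simp

section \<open>The row word of a standard tableau\<close>

lemma in_diagram_iff: "(i, c) \<in> diagram lam \<longleftrightarrow> i \<in> {1..length lam} \<and> c \<in> {1..part lam i}"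
  by (auto simp: diagram_def)

lemma SYT_D:
  assumes "T \<in> SYT lam"
  shows "T \<in> extensional (diagram lam)"
    and "bij_betw T (diagram lam) {1..sum_list lam}"
    and "\<And>i c c'. (i, c) \<in> diagram lam \<Longrightarrow> (i, c') \<in> diagram lam \<Longrightarrow> c < c' \<Longrightarrow> T (i, c) < T (i, c')"
    and "\<And>i i' c. (i, c) \<in> diagram lam \<Longrightarrow> (i', c) \<in> diagram lam \<Longrightarrow> i < i' \<Longrightarrow> T (i, c) < T (i', c)"
  using assms unfolding SYT_def by blast+

definition row_word :: "nat list \<Rightarrow> (nat \<times> nat \<Rightarrow> nat) \<Rightarrow> nat list" where
  "row_word lam T = rev (map (\<lambda>j. row_of lam T j - 1) [1..<Suc (sum_list lam)])"

lemma row_of_eq: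
  assumes "inj_on T (diagram lam)" "(i, c) \<in> diagram lam"
  shows "row_of lam T (T (i, c)) = i"
  unfolding row_of_def
proof (rule the_equality)
  fix i' assume "\<exists>c'. (i', c') \<in> diagram lam \<and> T (i', c') = T (i, c)"
  then show "i' = i" using assms by (auto dest: inj_onD)
qed (use assms in auto)

context
  fixes lam T
  assumes T: "T \<in> SYT lam"
begin

lemma SYT_row_of [simp]: "(i, c) \<in> diagram lam \<Longrightarrow> row_of lam T (T (i, c)) = i"
  using row_of_eq bij_betw_imp_inj_on[OF SYT_D(2)[OF T]] by blast

lemma SYT_box:
  assumes "j \<in> {1..sum_list lam}"
  obtains c where "(row_of lam T j, c) \<in> diagram lam" "T (row_of lam T j, c) = j"
proof -
  have "j \<in> T ` diagram lam"
    using assms bij_betw_imp_surj_on[OF SYT_D(2)[OF T]] by simp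
  then show ?thesis using that by auto
qed

lemma SYT_row_of_range: "j \<in> {1..sum_list lam} \<Longrightarrow> row_of lam T j \<in> {1..length lam}"
  by (rule SYT_box) (auto simp: in_diagram_iff)

lemma SYT_range: "(i, c) \<in> diagram lam \<Longrightarrow> T (i, c) \<in> {1..sum_list lam}"
  using bij_betw_imp_surj_on[OF SYT_D(2)[OF T]] by blast

lemma SYT_row_set:
  assumes "i \<in> {1..length lam}"
  shows "(\<lambda>c. T (i, c)) ` {1..part lam i} = {j\<in>{1..sum_list lam}. row_of lam T j = i}"
proof (intro equalityI subsetI)
  fix j assume "j \<in> {j\<in>{1..sum_list lam}. row_of lam T j = i}"
  then have j: "j \<in> {1..sum_list lam}" "row_of lam T j = i" by auto
  obtain c where "(i, c) \<in> diagram lam" "T (i, c) = j"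
    using SYT_box[OF j(1)] j(2) by auto
  then show "j \<in> (\<lambda>c. T (i, c)) ` {1..part lam i}"
    by (auto simp: in_diagram_iff)
qed (use assms SYT_range in_diagram_iff in auto)

lemma SYT_row_strict_mono:
  "i \<in> {1..length lam} \<Longrightarrow> strict_mono_on {1..part lam i} (\<lambda>c. T (i, c))"
  by (rule strict_mono_onI) (simp add: SYT_D(3)[OF T] in_diagram_iff)

text \<open>A row is increasing, so it is the sorted list of its entries; hence the rows of the
  entries determine the tableau. Columns start at 1 and list indices at 0.\<close>

lemma SYT_eq_nth:
  assumes "(i, c) \<in> diagram lam"
  shows "T (i, c) = sorted_list_of_set {j\<in>{1..sum_list lam}. row_of lam T j = i} ! (c - 1)"
proof -
  have i: "i \<in> {1..length lam}" and c: "c \<in> {1..part lam i}"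
    using assms by (auto simp: in_diagram_iff)
  have "sorted_wrt (<) (map (\<lambda>c. T (i, c)) [1..<Suc (part lam i)])"
    unfolding sorted_wrt_map
    by (rule sorted_wrt_mono_rel[OF _ sorted_wrt_upt])
      (use SYT_row_strict_mono[OF i] in \<open>auto simp: strict_mono_on_def\<close>)
  then have "sorted_list_of_set (set (map (\<lambda>c. T (i, c)) [1..<Suc (part lam i)])) =
      map (\<lambda>c. T (i, c)) [1..<Suc (part lam i)]"
    by (metis List.finite_set sorted_list_of_set.sorted_key_list_of_set_unique strict_sorted_iff
        distinct_card)
  moreover have "set (map (\<lambda>c. T (i, c)) [1..<Suc (part lam i)]) =
      {j\<in>{1..sum_list lam}. row_of lam T j = i}"
    using SYT_row_set[OF i] by (simp add: atLeastLessThanSuc_atLeastAtMost del: upt_Suc)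
  ultimately have "sorted_list_of_set {j\<in>{1..sum_list lam}. row_of lam T j = i} =
      map (\<lambda>c. T (i, c)) [1..<Suc (part lam i)]"
    by metis
  moreover have "[1..<Suc (part lam i)] ! (c - 1) = c" "c - 1 < part lam i"
    using c by (auto simp del: upt_Suc)
  ultimately show ?thesis
    by (simp only: nth_map length_upt diff_Suc_1)
qed

lemma SYT_count_row_word:
  "count_list (row_word lam T) i = (if i < length lam then lam ! i else 0)"
proof -
  have "count_list (row_word lam T) i =
      card {j\<in>{1..sum_list lam}. row_of lam T j - 1 = i}"
    by (simp only: row_word_def count_list_rev_map_upt)
  \<comment> \<open>Rows are at least 1, so the truncated subtraction does not merge row 0 with row
    1.\<close>
  also have "{j\<in>{1..sum_list lam}. row_of lam T j - 1 = i} =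
      {j\<in>{1..sum_list lam}. row_of lam T j = Suc i}"
    using SYT_row_of_range by fastforce
  also have "card \<dots> = (if i < length lam then lam ! i else 0)"
  proof (cases "i < length lam")
    case True
    then have i: "Suc i \<in> {1..length lam}" by simp
    have "card {j\<in>{1..sum_list lam}. row_of lam T j = Suc i} = card {1..part lam (Suc i)}"
      unfolding SYT_row_set[OF i, symmetric]
      by (rule card_image[OF strict_mono_on_imp_inj_on[OF SYT_row_strict_mono[OF i]]])
    then show ?thesis
      using True by (simp add: part_def)
  next
    case False
    then have "{j\<in>{1..sum_list lam}. row_of lam T j = Suc i} = {}"
      using SYT_row_of_range by fastforce
    with False show ?thesis by (simp only: card.empty if_False)
  qed
  finally show ?thesis .
qed

lemma SYT_row_entries_lt:
  assumes "j \<le> sum_list lam"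
  shows "row_entries_lt lam T j i = {k\<in>{1..<j}. row_of lam T k = i}"
proof (intro equalityI subsetI)
  fix k assume "k \<in> {k\<in>{1..<j}. row_of lam T k = i}"
  then have k: "k \<in> {1..sum_list lam}" "row_of lam T k = i" "k < j" using assms by auto
  obtain c where "(i, c) \<in> diagram lam" "T (i, c) = k"
    using SYT_box[OF k(1)] k(2) by auto
  with k show "k \<in> row_entries_lt lam T j i"
    unfolding row_entries_lt_def by (intro CollectI exI[of _ c]) simp
qed (use SYT_range in \<open>fastforce simp: row_entries_lt_def\<close>)

text \<open>For \<open>j\<close> in row \<open>r \<ge> 2\<close>, both conditions say that the
  latest earlier entry in a row at least \<open>r - 1\<close> lies in row \<open>r - 1\<close>
  itself.\<close>

lemma richardson_iff_rich:
  assumes "is_partition lam"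
  shows "richardson lam T \<longleftrightarrow> rich (row_word lam T)"
proof -
  let ?r = "row_of lam T"
  have "(\<forall>i\<ge>?r j. \<forall>x\<in>row_entries_lt lam T j i. x < Max (row_entries_lt lam T j (?r j - 1))) \<longleftrightarrow>
      (\<exists>k\<in>{1..<j}. ?r k - 1 = z \<and> (\<forall>k'\<in>{k<..<j}. ?r k' - 1 < z))"
    if j: "j \<in> {1..sum_list lam}" and z: "?r j - 1 = Suc z" for j z
  proof -
    define A where "A = {k\<in>{1..<j}. ?r k = Suc z}"
    have rj: "?r j = Suc (Suc z)" using z by simp
    obtain c where c: "(Suc (Suc z), c) \<in> diagram lam" "T (Suc (Suc z), c) = j"
      using SYT_box[OF j] rj by auto
    have "part lam (Suc (Suc z)) \<le> part lam (Suc z)"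
      using assms c by (auto simp: is_partition_def part_def in_diagram_iff sorted_wrt_iff_nth_less)
    then have c': "(Suc z, c) \<in> diagram lam"
      using c(1) by (auto simp: in_diagram_iff)
    \<comment> \<open>The entry directly above \<open>j\<close> shows that the maximum is taken over
      a nonempty set.\<close>
    have "T (Suc z, c) \<in> A"
      using SYT_D(4)[OF T c' c(1)] c(2) SYT_range[OF c'] c' by (auto simp: A_def)
    then have A: "finite A" "A \<noteq> {}" by (auto simp: A_def)
    have pos: "?r k \<ge> 1" if "k \<in> {1..<j}" for k
      using SYT_row_of_range[of k] that j by auto
    have "(\<forall>i\<ge>?r j. \<forall>x\<in>row_entries_lt lam T j i. x < Max (row_entries_lt lam T j (?r j - 1))) \<longleftrightarrow>
        (\<forall>x\<in>{1..<j}. ?r x \<ge> Suc (Suc z) \<longrightarrow> x < Max A)"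
      using j by (auto simp: SYT_row_entries_lt rj A_def)
    also have "\<dots> \<longleftrightarrow> (\<exists>k\<in>{1..<j}. ?r k - 1 = z \<and> (\<forall>k'\<in>{k<..<j}. ?r k' - 1 < z))"
    proof
      assume *: "\<forall>x\<in>{1..<j}. ?r x \<ge> Suc (Suc z) \<longrightarrow> x < Max A"
      \<comment> \<open>The position sought is \<open>Max A\<close>: later entries before
        \<open>j\<close> lie neither in row \<open>Suc z\<close> nor below it.\<close>
      have M: "Max A \<in> A" using A by (rule Max_in)
      have "?r k' - 1 < z" if "k' \<in> {Max A<..<j}" for k'
      proof -
        have "k' \<notin> A" using that Max_ge[OF A(1), of k'] by auto
        moreover have "\<not> ?r k' \<ge> Suc (Suc z)" using that * M by (auto simp: A_def)
        moreover have "k' \<in> {1..<j}" using that by auto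
        ultimately show ?thesis using pos[of k'] by (auto simp: A_def)
      qed
      moreover have "Max A \<in> {1..<j}" "?r (Max A) - 1 = z"
        using M by (auto simp: A_def)
      ultimately show "\<exists>k\<in>{1..<j}. ?r k - 1 = z \<and> (\<forall>k'\<in>{k<..<j}. ?r k' - 1 < z)"
        by blast
    next
      assume "\<exists>k\<in>{1..<j}. ?r k - 1 = z \<and> (\<forall>k'\<in>{k<..<j}. ?r k' - 1 < z)"
      then obtain k where k: "k \<in> {1..<j}" "?r k - 1 = z" "\<And>k'. k' \<in> {k<..<j} \<Longrightarrow> ?r k' - 1 < z"
        by blast
      then have "k \<in> A" using pos[of k] by (auto simp: A_def)
      then have "k \<le> Max A" using A by simp
      moreover have "x < k" if "x \<in> {1..<j}" "?r x \<ge> Suc (Suc z)" for x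
        using k(3)[of x] k(2) that by (cases x k rule: linorder_cases) auto
      ultimately show "\<forall>x\<in>{1..<j}. ?r x \<ge> Suc (Suc z) \<longrightarrow> x < Max A"
        by (meson order_less_le_trans)
    qed
    finally show ?thesis .
  qed
  moreover have "?r j \<ge> 2 \<longleftrightarrow> (\<exists>z. ?r j - 1 = Suc z)" for j
    by presburger
  ultimately show ?thesis
    unfolding richardson_def row_word_def rich_rev_map_upt by blast
qed

lemma comaj_eq_zero_stat:
  assumes "rich (row_word lam T)"
  shows "comaj lam T = zero_stat (row_word lam T)"
proof -
  have "ascents lam T =
      {i\<in>{1..<sum_list lam}. row_of lam T (Suc i) - 1 \<le> row_of lam T i - 1}"
    using SYT_row_of_range by (fastforce simp: ascents_def descents_def)
  then show ?thesis
    using zero_stat_rev_map_upt assms by (simp only: comaj_def row_word_def)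
qed

end

lemma inj_on_row_word: "inj_on (row_word lam) (SYT lam)"
proof (rule inj_onI)
  fix T T' assume T: "T \<in> SYT lam" and T': "T' \<in> SYT lam"
    and eq: "row_word lam T = row_word lam T'"
  have "row_of lam T j = row_of lam T' j" if "j \<in> {1..sum_list lam}" for j
  proof -
    have "row_of lam T j - 1 = row_of lam T' j - 1"
      using eq that unfolding row_word_def rev_is_rev_conv map_eq_conv by (simp del: upt_Suc)
    then show ?thesis
      using SYT_row_of_range[OF T that] SYT_row_of_range[OF T' that] by auto
  qed
  then have "{j\<in>{1..sum_list lam}. row_of lam T j = i} =
      {j\<in>{1..sum_list lam}. row_of lam T' j = i}" for i
    by auto
  then have "T x = T' x" if "x \<in> diagram lam" for x
    using SYT_eq_nth[OF T] SYT_eq_nth[OF T'] that by (cases x) simp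
  then show "T = T'"
    using SYT_D(1)[OF T] SYT_D(1)[OF T'] by (rule extensionalityI[rotated 2])
qed

text \<open>Turns the ballot inequality into column strictness for adjacent rows: \<open>c\<close>
  elements of \<open>ys\<close> precede \<open>ys ! c\<close>, so more than \<open>c\<close>
  elements of \<open>xs\<close> do, and \<open>xs ! c\<close> is among them.\<close>

lemma strict_sorted_nth_less:
  assumes "sorted_wrt (<) xs" "sorted_wrt (<) ys"
    and "\<And>y. y \<in> set ys \<Longrightarrow> card {x\<in>set ys. x < y} < card {x\<in>set xs. x < y}"
    and "c < length ys"
  shows "c < length xs \<and> xs ! c < (ys ! c :: nat)"
proof -
  have "(!) ys ` {..<c} \<subseteq> {y\<in>set ys. y < ys ! c}"
    using assms(2,4) by (auto simp: sorted_wrt_iff_nth_less)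
  moreover have "inj_on ((!) ys) {..<c}"
    using assms(2,4) by (auto simp: inj_on_def strict_sorted_iff nth_eq_iff_index_eq)
  ultimately have "c \<le> card {y\<in>set ys. y < ys ! c}"
    using card_inj_on_le[of "(!) ys" "{..<c}" "{y\<in>set ys. y < ys ! c}"] by simp
  then have *: "c < card {x\<in>set xs. x < ys ! c}"
    using assms(3)[of "ys ! c"] assms(4) by simp
  show ?thesis
  proof (rule ccontr)
    assume neg: "\<not> ?thesis"
    have "ys ! c \<le> xs ! i" if "i < length xs" "c \<le> i" for i
    proof -
      have "xs ! c \<le> xs ! i"
        using assms(1) that by (cases "c = i") (auto simp: sorted_wrt_iff_nth_less less_imp_le)
      with neg that show ?thesis by simp
    qed
    \<comment> \<open>Only the first \<open>c\<close> entries of \<open>xs\<close> could then be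
      below \<open>ys ! c\<close>, contradicting the count.\<close>
    then have "{x\<in>set xs. x < ys ! c} \<subseteq> (!) xs ` {..<c}"
      by (force simp: in_set_conv_nth)
    then have "card {x\<in>set xs. x < ys ! c} \<le> c"
      using surj_card_le[of "{..<c}"] by simp
    with * show False by simp
  qed
qed

text \<open>Row \<open>i\<close> lists in increasing order the positions of the letter
  \<open>i - 1\<close>. Rows increase by construction; columns increase by the ballot
  condition.\<close>

lemma row_word_surj:
  assumes w: "w \<in> rich_words lam"
  shows "\<exists>T\<in>SYT lam. row_word lam T = w"
proof -
  define n where "n = sum_list lam"
  define f where "f j = rev w ! (j - 1)" for j
  have len: "length w = n" using length_rich_words[OF w] by (simp add: n_def)
  have "rev w = map f [1..<Suc n]"
    by (rule nth_equalityI) (simp_all add: len f_def del: upt_Suc)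
  then have wf: "w = rev (map f [1..<Suc n])"
    by (metis rev_rev_ident)
  have rich: "rich w" and cnt: "\<And>i. count_list w i = (if i < length lam then lam ! i else 0)"
    using w by (auto simp: rich_words_def)
  define A where "A i = {j\<in>{1..n}. f j = i - 1}" for i
  define L where "L i = sorted_list_of_set (A i)" for i
  define T where "T = restrict (\<lambda>(i, c). L i ! (c - 1)) (diagram lam)"
  note count_prefix = count_list_rev_map_upt[of f]
  have finA: "finite (A i)" for i by (simp add: A_def)
  have setL: "set (L i) = A i" and sortL: "sorted_wrt (<) (L i)" and distL: "distinct (L i)" for i
    using finA by (auto simp: L_def)
  have lenL: "length (L i) = part lam i" if "i \<in> {1..length lam}" for i
  proof -
    have "length (L i) = card (A i)" by (simp add: L_def)
    also have "\<dots> = count_list w (i - 1)"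
      by (subst wf, subst count_prefix) (simp add: A_def)
    also have "\<dots> = part lam i" using that by (auto simp: cnt part_def)
    finally show ?thesis .
  qed
  have T_eq: "T (i, c) = L i ! (c - 1)" if "(i, c) \<in> diagram lam" for i c
    using that by (simp add: T_def)
  have row_image: "(\<lambda>c. L i ! (c - 1)) ` {1..part lam i} = A i" if "i \<in> {1..length lam}" for i
  proof -
    have "(\<lambda>c. L i ! (c - 1)) ` {1..part lam i} = (!) (L i) ` {..<part lam i}"
      by (force simp: image_iff Bex_def)
    also have "\<dots> = A i"
      using setL[of i] lenL[OF that] by (auto simp: set_conv_nth)
    finally show ?thesis .
  qed
  have inA: "T (i, c) \<in> A i" if "(i, c) \<in> diagram lam" for i c
    using that row_image[of i] by (auto simp: T_eq in_diagram_iff)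
  have f_bound: "f j < length lam" if "j \<in> {1..n}" for j
  proof (rule ccontr)
    assume "\<not> ?thesis"
    then have "count_list w (f j) = 0" by (simp add: cnt)
    moreover have "f j \<in> set w" using that by (subst wf) (auto simp del: upt_Suc)
    ultimately show False by (simp add: count_list_0_iff)
  qed
  have "inj_on T (diagram lam)"
  proof (rule inj_onI, clarify)
    fix i c i' c' assume d: "(i, c) \<in> diagram lam" "(i', c') \<in> diagram lam" "T (i, c) = T (i', c')"
    have "i - 1 = i' - 1" using inA[OF d(1)] inA[OF d(2)] d(3) by (auto simp: A_def)
    then have i: "i = i'" using d by (auto simp: in_diagram_iff)
    then have "c - 1 = c' - 1"
      using d distL[of i] lenL[of i] by (auto simp: T_eq in_diagram_iff nth_eq_iff_index_eq)
    then show "i = i' \<and> c = c'" using i d by (auto simp: in_diagram_iff)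
  qed
  moreover have "T ` diagram lam = {1..n}"
  proof (intro equalityI subsetI)
    fix j assume j: "j \<in> {1..n}"
    then have "j \<in> A (Suc (f j))" "Suc (f j) \<in> {1..length lam}"
      using f_bound[of j] by (auto simp: A_def)
    then obtain c where "c \<in> {1..part lam (Suc (f j))}" "j = L (Suc (f j)) ! (c - 1)"
      using row_image by blast
    then have "(Suc (f j), c) \<in> diagram lam" "T (Suc (f j), c) = j"
      using \<open>Suc (f j) \<in> _\<close> by (auto simp: in_diagram_iff T_eq)
    then show "j \<in> T ` diagram lam" by force
  qed (use inA in \<open>auto simp: A_def\<close>)
  ultimately have bij: "bij_betw T (diagram lam) {1..sum_list lam}"
    by (simp add: bij_betw_def n_def)
  have rows: "T (i, c) < T (i, c')"
    if "(i, c) \<in> diagram lam" "(i, c') \<in> diagram lam" "c < c'" for i c c'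
    using that sortL[of i] lenL[of i]
    by (auto simp: T_eq in_diagram_iff sorted_wrt_iff_nth_less)
  have step: "(i, c) \<in> diagram lam \<and> T (i, c) < T (Suc i, c)" if d: "(Suc i, c) \<in> diagram lam" "i \<ge> 1" for i c
  proof -
    \<comment> \<open>Cut the word just before the letter at position \<open>y = Suc m\<close>. The
      rest \<open>v\<close> can be followed by \<open>Suc z\<close>, so \<open>rich_ballot\<close>
      gives its strict inequality for \<open>v\<close>.\<close>
    have less: "card {x\<in>A (Suc i). x < y} < card {x\<in>A i. x < y}" if y: "y \<in> A (Suc i)" for y
    proof -
      obtain z where z: "i = Suc z" using d(2) by (cases i) auto
      obtain m where m: "y = Suc m" "m < n" "f y = Suc z"
        using y by (cases y) (auto simp: A_def z)
      define v where "v = rev (map f [1..<Suc m])"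
      have "[1..<Suc n] = [1..<Suc m] @ [Suc m..<Suc n]"
        using m upt_add_eq_append[of 1 "Suc m" "n - m"] by simp
      moreover have "[Suc m..<Suc n] = Suc m # [Suc (Suc m)..<Suc n]"
        using m by (simp add: upt_conv_Cons del: upt_Suc)
      ultimately have "w = rev (map f [Suc (Suc m)..<Suc n]) @ f (Suc m) # v"
        by (simp add: wf v_def del: upt_Suc)
      moreover have "rich v" if "rich (u @ v)" for u v
        using that by (induction u) auto
      ultimately have "rich (f (Suc m) # v)" using rich by metis
      then have "count_list v (Suc z) < count_list v z"
        using rich_ballot[of v z] m by auto
      moreover have "{x\<in>A (Suc i). x < y} = {j\<in>{1..m}. f j = Suc z}"
        "{x\<in>A i. x < y} = {j\<in>{1..m}. f j = z}"
        using m by (auto simp: A_def z)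
      ultimately show ?thesis by (simp only: v_def count_prefix)
    qed
    have "c - 1 < length (L i) \<and> L i ! (c - 1) < L (Suc i) ! (c - 1)"
      by (rule strict_sorted_nth_less) (use sortL less d lenL[of "Suc i"] in \<open>auto simp: setL in_diagram_iff\<close>)
    moreover from this have "(i, c) \<in> diagram lam"
      using d lenL[of i] by (auto simp: in_diagram_iff)
    ultimately show ?thesis using d by (simp add: T_eq)
  qed
  have cols: "T (i, c) < T (i', c)"
    if d: "(i, c) \<in> diagram lam" "(i', c) \<in> diagram lam" and "i < i'" for i i' c
  proof -
    have "i \<ge> 1" using d(1) by (simp add: in_diagram_iff)
    \<comment> \<open>Induction down the column; \<open>step\<close> also provides the boxes in
      between.\<close>
    have "T (i, c) < T (Suc (i + k), c)" if "(Suc (i + k), c) \<in> diagram lam" for k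
      using that
    proof (induction k)
      case 0
      then show ?case using step[of i c] \<open>i \<ge> 1\<close> by simp
    next
      case (Suc k)
      then show ?case using step[of "Suc (i + k)" c] by auto
    qed
    then show ?thesis using less_imp_Suc_add[OF \<open>i < i'\<close>] d(2) by auto
  qed
  have "T \<in> extensional (diagram lam)" by (simp add: T_def)
  with bij rows cols have SYT: "T \<in> SYT lam"
    unfolding SYT_def by blast
  have "row_of lam T j - 1 = f j" if "j \<in> {1..n}" for j
  proof -
    obtain c where "(row_of lam T j, c) \<in> diagram lam" "T (row_of lam T j, c) = j"
      using SYT_box[OF SYT] \<open>j \<in> {1..n}\<close> n_def by blast
    then show ?thesis
      using inA[of "row_of lam T j" c] by (simp add: A_def)
  qed
  then have "row_word lam T = w"
    unfolding wf row_word_def n_def[symmetric]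
    by (intro arg_cong[of _ _ rev] map_cong) auto
  with SYT show ?thesis by blast
qed

lemma bij_betw_row_word:
  assumes "is_partition lam"
  shows "bij_betw (row_word lam) (richardson_tableaux lam) (rich_words lam)"
  unfolding bij_betw_def
proof
  show "inj_on (row_word lam) (richardson_tableaux lam)"
    by (rule inj_on_subset[OF inj_on_row_word]) (auto simp: richardson_tableaux_def)
  show "row_word lam ` richardson_tableaux lam = rich_words lam"
  proof (intro equalityI subsetI)
    fix w assume w: "w \<in> rich_words lam"
    then obtain T where T: "T \<in> SYT lam" "row_word lam T = w"
      using row_word_surj by blast
    moreover have "rich w" using w by (simp add: rich_words_def)
    ultimately show "w \<in> row_word lam ` richardson_tableaux lam"
      using richardson_iff_rich[OF T(1) assms] by (auto simp: richardson_tableaux_def)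
  qed (use richardson_iff_rich[OF _ assms] SYT_count_row_word in
      \<open>auto simp: richardson_tableaux_def rich_words_def\<close>)
qed

section \<open>Passing to the formula with parts numbered from 1\<close>

lemma double_choose_two: "2 * (k choose 2) = k * (k - 1)"
  by (cases k) (auto simp: choose_two)

theorem corollary1p4:
  fixes lam :: "nat list"
  assumes "is_partition lam"
  shows "(\<Sum>T\<in>richardson_tableaux lam. qvar ^ comaj lam T) =
    qvar ^ ((\<Sum>i=1..length lam. part lam i * (part lam i - 1)) div 2) *
    (\<Prod>i=1..length lam - 1.
       q_binomial qvar
         (part lam i + (\<Sum>j=i+2..length lam. part lam j))
         (part lam (i + 1) + (\<Sum>j=i+2..length lam. part lam j)))"
proof -
  have tail: "sum_list (drop k lam) = (\<Sum>j=Suc k..length lam. part lam j)" for k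
  proof -
    have "sum_list (drop k lam) = (\<Sum>i<length lam - k. lam ! (k + i))"
      by (simp add: sum_list_sum_nth atLeast0LessThan)
    also have "\<dots> = (\<Sum>j=Suc k..length lam. part lam j)"
      by (rule sum.reindex_bij_witness[of _ "\<lambda>j. j - Suc k" "\<lambda>i. Suc k + i"])
        (auto simp: part_def)
    finally show ?thesis .
  qed
  have "(\<Sum>x\<leftarrow>lam. x choose 2) = (\<Sum>i<length lam. lam ! i choose 2)"
    by (simp add: sum_list_sum_nth atLeast0LessThan)
  also have "\<dots> = (\<Sum>i=1..length lam. part lam i choose 2)"
    by (rule sum.reindex_bij_witness[of _ "\<lambda>i. i - 1" Suc]) (auto simp: part_def)
  \<comment> \<open>Doubling first shows that the division by 2 in the exponent is exact.\<close>
  finally have "2 * (\<Sum>x\<leftarrow>lam. x choose 2) = (\<Sum>i=1..length lam. 2 * (part lam i choose 2))"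
    by (simp add: sum_distrib_left)
  also have "\<dots> = (\<Sum>i=1..length lam. part lam i * (part lam i - 1))"
    by (rule sum.cong) (simp_all add: double_choose_two)
  finally have expo: "(\<Sum>x\<leftarrow>lam. x choose 2) =
      (\<Sum>i=1..length lam. part lam i * (part lam i - 1)) div 2"
    by simp
  have "(\<Sum>T\<in>richardson_tableaux lam. qvar ^ comaj lam T) =
      (\<Sum>T\<in>richardson_tableaux lam. qvar ^ zero_stat (row_word lam T))"
    by (rule sum.cong)
      (auto simp: richardson_tableaux_def comaj_eq_zero_stat richardson_iff_rich assms)
  also have "\<dots> = (\<Sum>w\<in>rich_words lam. qvar ^ zero_stat w)"
    by (rule sum.reindex_bij_betw[OF bij_betw_row_word[OF assms]])
  also have "\<dots> = qvar ^ (\<Sum>x\<leftarrow>lam. x choose 2) *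
    (\<Prod>i<length lam - 1.
       q_binomial qvar (lam ! i + sum_list (drop (i + 2) lam))
         (lam ! Suc i + sum_list (drop (i + 2) lam)))"
    using assms by (intro sum_rich_words qvar_power_neq_1) (simp_all add: is_partition_def)
  \<comment> \<open>Under the shift from \<open>i\<close> to \<open>i + 1\<close>, dropping
    \<open>i + 2\<close> parts leaves those from number \<open>i + 3\<close> on, which is the new
    index plus 2.\<close>
  also have "(\<Prod>i<length lam - 1.
       q_binomial qvar (lam ! i + sum_list (drop (i + 2) lam))
         (lam ! Suc i + sum_list (drop (i + 2) lam))) =
    (\<Prod>i=1..length lam - 1.
       q_binomial qvar
         (part lam i + (\<Sum>j=i+2..length lam. part lam j))
         (part lam (i + 1) + (\<Sum>j=i+2..length lam. part lam j)))"
    by (rule prod.reindex_bij_witness[of _ "\<lambda>i. i - 1" Suc]) (auto simp: part_def tail)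
  finally show ?thesis unfolding expo .
qed

end
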